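(* Let $p,q$ be complex numbers with $\Re(p)>0$, $\Re(q)>0$, and let $a,b$ be any real numbers such that $a,b>1$. The generalized polylogarithm function $\Phi_{p,q}(a,b;z)$ admits the integral representation $$\Phi_{p,q}(a,b;z) = (1+a)^p(1+b)^q\left(\frac{zq}{\Gamma(p)}\int_0^\infty\int_0^\infty e^{-qu}\,e^{-(a+1)v}\,v^{p-1}\,\frac{1-(ze^{-v})^{\lfloor e^u-b\rfloor}}{1-ze^{-v}}\,du\,dv\right)$$ for all $|z|<1$.
   Context: For $a,b>0$ and complex $p,q$ with $\Re(p)>0$, $\Re(q)>0$, the generalized polylogarithm is $$\Phi_{p,q}(a,b;z) = \sum_{k=1}^\infty \frac{(1+a)^p(1+b)^q}{(k+a)^p(k+b)^q} z^k, \qquad |z|<1.$$ $\lfloor\cdot\rfloor$ denotes the greatest integer function, and $\Gamma$ is the Gamma function.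
   Formalization: The exponent ⌊e^u−b⌋ is replaced by max(0,⌊e^u−b⌋), so the integrand vanishes for u<ln b; with literal negative powers the formula is undefined at z=0 and false, e.g. for 1<b≤2 and z≠0, by the extra bracket term −(1−b^{−q})a^{−p}. *)

theory Defs
  imports "HOL-Analysis.Analysis"
begin

text \<open>The generalized polylogarithm; the library's series start at \<open>0\<close>, so the summation
  index \<open>k \<ge> 1\<close> appears as \<open>Suc k\<close>.\<close>

definition gen_polylog ::
    "complex \<Rightarrow> complex \<Rightarrow> real \<Rightarrow> real \<Rightarrow> complex \<Rightarrow> complex" where
  "gen_polylog p q a b z =
     (\<Sum>k. (complex_of_real (1 + a) powr p * complex_of_real (1 + b) powr q) /
           (complex_of_real (real (Suc k) + a) powr p * complex_of_real (real (Suc k) + b) powr q)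
           * z ^ Suc k)"

text \<open>The exponent \<open>\<lfloor>e\<^sup>u - b\<rfloor>\<close> is the number \<open>N\<close> of integers \<open>k \<ge> 1\<close> with \<open>k + b \<le> e\<^sup>u\<close>, and
  \<open>(1 - w\<^sup>N) / (1 - w)\<close> is the geometric sum \<open>1 + w + \<dots> + w\<^sup>N\<^sup>-\<^sup>1\<close> with \<open>w = z e\<^sup>-\<^sup>v\<close>.
  For \<open>0 \<le> u < ln b\<close> the floor is negative and the sum is empty: there \<open>nat\<close> makes the
  exponent \<open>0\<close> and the integrand vanishes. Negative integer powers of \<open>w\<close> in that range
  would be undefined at \<open>z = 0\<close> and would in general make the representation false for \<open>z \<noteq> 0\<close>.\<close>

definition gen_polylog_integrand ::
    "complex \<Rightarrow> complex \<Rightarrow> real \<Rightarrow> real \<Rightarrow> complex \<Rightarrow> real \<Rightarrow> real \<Rightarrow> complex" where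
  "gen_polylog_integrand p q a b z u v =
     exp (- q * complex_of_real u) * complex_of_real (exp (- (a + 1) * v))
       * complex_of_real v powr (p - 1)
       * ((1 - (z * complex_of_real (exp (- v))) ^ nat \<lfloor>exp u - b\<rfloor>)
          / (1 - z * complex_of_real (exp (- v))))"

end

theory Submission
  imports Defs
begin

text \<open>The inequality \<open>n + 1 \<le> \<lfloor>e\<^sup>u - b\<rfloor>\<close> means \<open>u \<ge> ln (n + 1 + b)\<close>, so expanding the geometric sum
  writes the integrand as a series whose \<open>n\<close>-th term is \<open>z\<^sup>n\<close> times a function of \<open>u\<close>, the
  exponential \<open>e\<^sup>-\<^sup>q\<^sup>u\<close> cut off to the left of \<open>ln (n + 1 + b)\<close>, times the Gamma integrand
  \<open>e\<^sup>-\<^sup>(\<^sup>n\<^sup>+\<^sup>1\<^sup>+\<^sup>a\<^sup>)\<^sup>v v\<^sup>p\<^sup>-\<^sup>1\<close>. The two factors integrate to \<open>(n + 1 + b)\<^sup>-\<^sup>q / q\<close> and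
  \<open>\<Gamma>(p) / (n + 1 + a)\<^sup>p\<close>. All terms are dominated by \<open>|z|\<^sup>n\<close> times one integrable function, so
  the series may be integrated term by term, and Fubini's theorem applies.\<close>

text \<open>The norm of the product factors, so its iterated integral is finite. This yields
  integrability on the product, and Fubini then gives the value.\<close>

lemma (in pair_sigma_finite) has_bochner_integral_mult_pair:
  fixes f :: "'a \<Rightarrow> 'c::{real_normed_field,banach,second_countable_topology}"
  assumes "has_bochner_integral M1 f I" and "has_bochner_integral M2 g J"
  shows "has_bochner_integral (M1 \<Otimes>\<^sub>M M2) (\<lambda>(x, y). f x * g y) (I * J)"
proof -
  have f: "integrable M1 f" "integral\<^sup>L M1 f = I" and g: "integrable M2 g" "integral\<^sup>L M2 g = J"
    using assms by (auto simp: has_bochner_integral_iff)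
  have [measurable]: "f \<in> borel_measurable M1" "g \<in> borel_measurable M2"
    using f(1) g(1) by auto
  have *: "integrable (M1 \<Otimes>\<^sub>M M2) (\<lambda>(x, y). f x * g y)"
  proof (rule Fubini_integrable)
    show "integrable M1 (\<lambda>x. \<integral> y. norm (case (x, y) of (x, y) \<Rightarrow> f x * g y) \<partial>M2)"
      using f(1) by (simp add: norm_mult)
  qed (use g(1) in auto)
  have "integral\<^sup>L (M1 \<Otimes>\<^sub>M M2) (\<lambda>(x, y). f x * g y) = I * J"
    using integral_fst[OF *] f g by simp
  with * show ?thesis
    by (simp add: has_bochner_integral_iff)
qed

text \<open>Integrability comes from the modulus \<open>exp (- Re q * u)\<close>. The value comes
  from the antiderivative \<open>- exp (- q * of_real u) / q\<close>, which vanishes at infinity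
  because \<open>Re q > 0\<close>.\<close>

lemma has_bochner_integral_exp_tail:
  fixes q :: complex and c :: real
  assumes "Re q > 0"
  shows "has_bochner_integral lborel (\<lambda>u. indicator {c..} u *\<^sub>R exp (- q * of_real u))
           (exp (- q * of_real c) / q)"
proof -
  have "(\<lambda>u. exp (- Re q * u)) absolutely_integrable_on {c..}"
    using has_integral_exp_minus_to_infinity[OF assms, of c]
    by (intro nonnegative_absolutely_integrable_1) (auto simp: integrable_on_def)
  \<comment> \<open>Absolute integrability refers to Lebesgue measure, the completion of
    \<open>lborel\<close>. For a Borel function both notions of integrability agree.\<close>
  hence "integrable lborel (\<lambda>u. indicator {c..} u *\<^sub>R exp (- Re q * u))"
    unfolding set_integrable_def by (subst (asm) integrable_completion) auto
  hence int: "integrable lborel (\<lambda>u. indicator {c..} u *\<^sub>R exp (- q * of_real u))"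
    by (rule Bochner_Integration.integrable_bound) (auto split: split_indicator)
  have einterval: "einterval c \<infinity> = {c<..}"
    by (auto simp: einterval_def)
  have int': "set_integrable lborel {c<..} (\<lambda>u. exp (- q * of_real u))"
    by (rule set_integrable_subset[OF int[folded set_integrable_def]]) auto
  have lim: "((\<lambda>x. - exp (- q * of_real x) / q) \<longlongrightarrow> 0) at_top"
  proof (rule tendsto_norm_zero_cancel)
    have "((\<lambda>x. exp (- Re q * x) / norm q) \<longlongrightarrow> 0) at_top"
      using assms by (intro tendsto_divide_zero filterlim_compose[OF exp_at_bot]
          filterlim_tendsto_neg_mult_at_bot[OF tendsto_const _ filterlim_ident]) auto
    thus "((\<lambda>x. norm (- exp (- q * of_real x) / q)) \<longlongrightarrow> 0) at_top"
      by (simp add: norm_divide)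
  qed
  have q: "q \<noteq> 0" using assms by auto
  have "(LBINT u=c..\<infinity>. exp (- q * of_real u)) = 0 - (- exp (- q * of_real c) / q)"
  proof (rule interval_integral_FTC_integrable)
    fix x :: real
    show "((\<lambda>x. - exp (- q * of_real x) / q) has_vector_derivative exp (- q * of_real x)) (at x)"
      using q by (auto intro!: derivative_eq_intros has_vector_derivative_real_field)
    show "isCont (\<lambda>u. exp (- q * of_real u)) x"
      by (intro continuous_intros)
  next
    show "set_integrable lborel (einterval c \<infinity>) (\<lambda>u. exp (- q * of_real u))"
      using int' by (simp add: einterval)
    show "(((\<lambda>x. - exp (- q * of_real x) / q) \<circ> real_of_ereal) \<longlongrightarrow> - exp (- q * of_real c) / q) (at_right (ereal c))"
      unfolding ereal_tendsto_simps by (intro tendsto_intros q)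
    show "(((\<lambda>x. - exp (- q * of_real x) / q) \<circ> real_of_ereal) \<longlongrightarrow> 0) (at_left \<infinity>)"
      unfolding ereal_tendsto_simps by (rule lim)
  qed auto
  hence "(LINT u:{c<..}|lborel. exp (- q * of_real u)) = exp (- q * of_real c) / q"
    by (simp add: interval_lebesgue_integral_def einterval)
  \<comment> \<open>The fundamental theorem of calculus gave the open half-line; the endpoint is a
    null set.\<close>
  also have "(LINT u:{c<..}|lborel. exp (- q * of_real u)) = (LINT u:{c..}|lborel. exp (- q * of_real u))"
    by (rule set_integral_discrete_difference[of "{c}"]) auto
  finally show ?thesis
    using int by (simp add: has_bochner_integral_iff set_lebesgue_integral_def)
qed

text \<open>This is Euler's integral for \<open>Gamma p\<close> after substituting
  \<open>s * v\<close> for the variable.\<close>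

lemma has_bochner_integral_Gamma_complex:
  fixes p :: complex and s :: real
  assumes "Re p > 0" and "s > 0"
  shows "has_bochner_integral lborel
           (\<lambda>v. indicator {0<..} v *\<^sub>R (of_real (exp (- s * v)) * of_real v powr (p - 1)))
           (Gamma p / of_real s powr p)"
proof -
  let ?g = "\<lambda>v. indicator {0<..} v *\<^sub>R (complex_of_real v powr (p - 1) / of_real (exp v))"
  \<comment> \<open>On positive reals the complex power is an exponential of the real logarithm, and
    in this form measurability is automatic.\<close>
  have "?g = (\<lambda>v. indicator {0<..} v *\<^sub>R (exp ((p - 1) * of_real (ln v)) / of_real (exp v)))"
    by (auto simp: fun_eq_iff powr_def Ln_of_real split: split_indicator)
  also have "\<dots> \<in> borel_measurable lborel"
    by measurable
  finally have meas: "?g \<in> borel_measurable lborel" .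
  have abs: "(\<lambda>v. complex_of_real v powr (p - 1) / of_real (exp v)) absolutely_integrable_on {0<..}"
    by (rule absolutely_integrable_Gamma_integral'[OF assms(1)])
  have int: "integrable lborel ?g"
    using abs meas unfolding set_integrable_def by (subst (asm) integrable_completion) auto
  have "integral\<^sup>L lborel ?g = integral\<^sup>L lebesgue ?g"
    using meas by (rule integral_completion[symmetric])
  also have "\<dots> = Gamma p"
    using set_lebesgue_integral_eq_integral(2)[OF abs] Gamma_integral_complex'[OF assms(1)]
    by (simp add: set_lebesgue_integral_def integral_unique)
  finally have "has_bochner_integral lborel ?g (Gamma p)"
    using int by (simp add: has_bochner_integral_iff)
  hence "has_bochner_integral lborel (\<lambda>v. ?g (0 + s * v)) (Gamma p /\<^sub>R \<bar>s\<bar>)"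
    using assms by (subst (asm) lborel_has_bochner_integral_real_affine_iff[of s _ _ 0]) auto
  \<comment> \<open>The factor \<open>of_real s powr (1 - p)\<close> cancels the power of
    \<open>s\<close> in \<open>(s * v) powr (p - 1)\<close>; with the Jacobian \<open>1 / s\<close>
    it leaves \<open>s\<close> to the power \<open>- p\<close>.\<close>
  hence "has_bochner_integral lborel (\<lambda>v. of_real s powr (1 - p) * ?g (0 + s * v))
           (of_real s powr (1 - p) * (Gamma p /\<^sub>R \<bar>s\<bar>))"
    by (intro has_bochner_integral_mult_right) auto
  also have "of_real s powr (1 - p) * (Gamma p /\<^sub>R \<bar>s\<bar>) = Gamma p / of_real s powr p"
    using assms by (simp add: powr_diff scaleR_conv_of_real field_simps)
  also have "(\<lambda>v. of_real s powr (1 - p) * ?g (0 + s * v)) =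
      (\<lambda>v. indicator {0<..} v *\<^sub>R (of_real (exp (- s * v)) * of_real v powr (p - 1)))"
  proof
    fix v :: real
    show "of_real s powr (1 - p) * ?g (0 + s * v) =
      indicator {0<..} v *\<^sub>R (of_real (exp (- s * v)) * of_real v powr (p - 1))"
    proof (cases "v > 0")
      case True
      have "complex_of_real (s * v) powr (p - 1) = of_real s powr (p - 1) * of_real v powr (p - 1)"
        using assms True by (simp add: powr_def Ln_of_real ln_mult exp_add ring_distribs Ln_times_of_real flip: of_real_mult)
      moreover have "complex_of_real s powr (1 - p) * of_real s powr (p - 1) = 1"
        using assms by (simp flip: powr_add)
      ultimately show ?thesis
        using assms True by (simp add: exp_minus field_simps)
    qed (use assms in \<open>auto simp: zero_less_mult_iff split: split_indicator\<close>)
  qed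
  finally show ?thesis .
qed

text \<open>For fixed \<open>u\<close> the cutoffs kill all terms with \<open>n >= N\<close>, so the
  series is a finite geometric sum. Its closed form is available since \<open>v > 0\<close> forces
  \<open>norm w < 1\<close>.\<close>

lemma gen_polylog_integrand_sums:
  fixes p q z :: complex and a b u v :: real
  assumes "b > 1" and "norm z < 1" and "u > 0" and "v > 0"
  shows "(\<lambda>n. z ^ n * ((indicator {ln (real (Suc n) + b)..} u *\<^sub>R exp (- q * of_real u)) *
            (of_real (exp (- (real (Suc n) + a) * v)) * of_real v powr (p - 1))))
         sums gen_polylog_integrand p q a b z u v"
proof -
  define N where "N = nat \<lfloor>exp u - b\<rfloor>"
  define w where "w = z * complex_of_real (exp (- v))"
  define C where "C = exp (- q * of_real u) * of_real (exp (- (a + 1) * v)) * complex_of_real v powr (p - 1)"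
  define f where "f = (\<lambda>n. z ^ n * ((indicator {ln (real (Suc n) + b)..} u *\<^sub>R exp (- q * of_real u)) *
            (of_real (exp (- (real (Suc n) + a) * v)) * of_real v powr (p - 1))))"
  have "norm w < 1"
    using mult_strict_mono[of "norm z" 1 "exp (- v)" 1] assms by (simp add: w_def norm_mult)
  hence "w \<noteq> 1" by auto
  have N: "ln (real (Suc n) + b) \<le> u \<longleftrightarrow> n < N" for n
  proof -
    have "ln (real (Suc n) + b) \<le> u \<longleftrightarrow> real (Suc n) + b \<le> exp u"
      using assms by (metis add_pos_pos exp_le_cancel_iff exp_ln of_nat_0_less_iff zero_less_Suc
          order.strict_trans zero_less_one)
    also have "\<dots> \<longleftrightarrow> int (Suc n) \<le> \<lfloor>exp u - b\<rfloor>"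
      by (simp add: le_floor_iff algebra_simps)
    \<comment> \<open>Truncation by \<open>nat\<close> is harmless: if the floor is negative, it is
      below \<open>Suc n\<close> and \<open>N = 0\<close>, so both sides are false.\<close>
    also have "\<dots> \<longleftrightarrow> n < N"
      unfolding N_def by linarith
    finally show ?thesis .
  qed
  have exp_eq: "exp (- (real (Suc n) + a) * v) = exp (- (a + 1) * v) * exp (- v) ^ n" for n
    by (simp add: algebra_simps flip: exp_add exp_of_nat_mult)
  have f: "f n = (if n < N then C * w ^ n else 0)" for n
    unfolding f_def exp_eq by (auto simp: indicator_def N C_def w_def power_mult_distrib simp del: of_nat_Suc)
  have "f sums (\<Sum>n<N. f n)"
    by (rule sums_finite) (auto simp: f)
  also have "(\<Sum>n<N. f n) = C * (\<Sum>n<N. w ^ n)"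
    by (simp add: f sum_distrib_left)
  also have "(\<Sum>n<N. w ^ n) = (1 - w ^ N) / (1 - w)"
    using sum_gp_strict[of w N] \<open>w \<noteq> 1\<close> by simp
  finally show ?thesis
    by (simp only: gen_polylog_integrand_def f_def C_def w_def N_def)
qed

text \<open>Bochner integrals of non-integrable functions default to 0, so integrability on the
  quadrant is asserted too, making the double integral a genuine one.\<close>

theorem theorem4p1:
  fixes p q z :: complex and a b :: real
  assumes "Re p > 0" and "Re q > 0"
    and "a > 1" and "b > 1"
    and "norm z < 1"
  shows "set_integrable (lborel \<Otimes>\<^sub>M lborel) ({0<..} \<times> {0<..})
           (\<lambda>(u, v). gen_polylog_integrand p q a b z u v) \<and>
         gen_polylog p q a b z =
           complex_of_real (1 + a) powr p * complex_of_real (1 + b) powr q *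
           (z * q / Gamma p *
             (LINT v:{0<..}|lborel. (LINT u:{0<..}|lborel. gen_polylog_integrand p q a b z u v)))"
proof -
  define c where "c n = ln (real (Suc n) + b)" for n
  define E where "E x u = indicator {x..} u *\<^sub>R exp (- q * of_real u)" for x u :: real
  define G where "G s v = indicator {0<..} v *\<^sub>R (of_real (exp (- s * v)) * of_real v powr (p - 1))"
    for s v :: real
  define T where "T n = (\<lambda>(u, v). z ^ n * (E (c n) u * G (real (Suc n) + a) v))" for n
  define I where "I = (\<lambda>u v. indicator ({0<..} \<times> {0<..}) (u, v) *\<^sub>R gen_polylog_integrand p q a b z u v)"

  have E: "has_bochner_integral lborel (E x) (exp (- q * of_real x) / q)" for x
    unfolding E_def using assms(2) by (rule has_bochner_integral_exp_tail)
  have G: "has_bochner_integral lborel (G s) (Gamma p / of_real s powr p)" if "s > 0" for s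
    unfolding G_def using assms(1) that by (rule has_bochner_integral_Gamma_complex)
  \<comment> \<open>Positivity makes \<open>E (c n)\<close> vanish for \<open>u <= 0\<close> and
    puts its support inside that of \<open>E 0\<close>.\<close>
  have c_pos: "c n > 0" for n
    unfolding c_def using assms by (intro ln_gt_zero) auto

  define t where "t n = z ^ n * ((1 / of_real (real (Suc n) + b) powr q / q) *
                     (Gamma p / of_real (real (Suc n) + a) powr p))" for n
  have "exp (- q * of_real (c n)) = 1 / of_real (real (Suc n) + b) powr q" for n
  proof -
    have "real (Suc n) + b > 0" using assms by simp
    thus ?thesis
      by (simp add: c_def powr_def Ln_of_real exp_minus divide_inverse del: of_nat_Suc of_real_add)
  qed
  hence T: "has_bochner_integral (lborel \<Otimes>\<^sub>M lborel) (T n) (t n)" for n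
    using has_bochner_integral_mult_right[OF
      lborel_pair.has_bochner_integral_mult_pair[OF E[of "c n"] G[of "real (Suc n) + a"]], of "z ^ n"] assms
    by (simp add: T_def t_def case_prod_unfold)
  have int_T: "integrable (lborel \<Otimes>\<^sub>M lborel) (T n)" for n
    using T by (rule integrable.intros)

  \<comment> \<open>A majorant independent of \<open>n\<close>: the cutoff \<open>c n\<close> is
    lowered to 0 and the decay rate \<open>real (Suc n) + a\<close> to 1.\<close>
  define H where "H = (\<lambda>(u, v). E 0 u * G 1 v)"
  have int_H: "integrable (lborel \<Otimes>\<^sub>M lborel) (\<lambda>x. norm (H x))"
    using integrable.intros[OF lborel_pair.has_bochner_integral_mult_pair[OF E[of 0] G[of 1]]]
    unfolding H_def by (intro integrable_norm) simp
  have T_le: "norm (T n x) \<le> norm z ^ n * norm (H x)" for n x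
  proof (cases x)
    case (Pair u v)
    have "norm (E (c n) u) \<le> norm (E 0 u)"
      using c_pos[of n] by (auto simp: E_def split: split_indicator)
    moreover have "norm (G (real (Suc n) + a) v) \<le> norm (G 1 v)"
    proof (cases "v > 0")
      case True
      hence "1 * v \<le> (real (Suc n) + a) * v"
        using assms by (intro mult_right_mono) auto
      thus ?thesis
        using True unfolding G_def norm_mult norm_scaleR norm_of_real abs_exp_cancel
        by (intro mult_left_mono mult_right_mono) (auto simp: algebra_simps)
    qed (simp add: G_def)
    ultimately have "norm (E (c n) u) * norm (G (real (Suc n) + a) v) \<le> norm (E 0 u) * norm (G 1 v)"
      by (rule mult_mono) auto
    thus ?thesis
      unfolding Pair T_def H_def prod.case norm_mult norm_power by (rule mult_left_mono) auto
  qed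
  have summable_T: "summable (\<lambda>n. norm (T n x))" for x
    using assms by (intro summable_comparison_test[OF _ summable_mult2[OF summable_geometric]])
      (auto intro: T_le)
  \<comment> \<open>The L1 norms are bounded by a geometric series, which justifies integrating term
    by term.\<close>
  have summable_int: "summable (\<lambda>n. \<integral>x. norm (T n x) \<partial>(lborel \<Otimes>\<^sub>M lborel))"
  proof (rule summable_comparison_test[OF _ summable_mult2[OF summable_geometric]])
    have "norm (\<integral>x. norm (T n x) \<partial>(lborel \<Otimes>\<^sub>M lborel)) \<le>
        norm z ^ n * (\<integral>x. norm (H x) \<partial>(lborel \<Otimes>\<^sub>M lborel))" for n
    proof -
      have "(\<integral>x. norm (T n x) \<partial>(lborel \<Otimes>\<^sub>M lborel)) \<le> 
          (\<integral>x. norm z ^ n * norm (H x) \<partial>(lborel \<Otimes>\<^sub>M lborel))"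
        by (intro integral_mono integrable_norm int_T integrable_mult_right int_H T_le)
      thus ?thesis by simp
    qed
    thus "\<exists>N. \<forall>n\<ge>N. norm (\<integral>x. norm (T n x) \<partial>(lborel \<Otimes>\<^sub>M lborel)) \<le>
        norm z ^ n * (\<integral>x. norm (H x) \<partial>(lborel \<Otimes>\<^sub>M lborel))"
      by blast
  qed (use assms in auto)

  \<comment> \<open>Extended by zero off the open quadrant, the expansion holds at every point, not
    just almost everywhere.\<close>
  have "(\<lambda>n. T n (u, v)) sums I u v" for u v
  proof (cases "u > 0 \<and> v > 0")
    case True
    thus ?thesis
      using gen_polylog_integrand_sums[OF assms(4,5), of u v q a p]
      by (simp add: I_def T_def E_def G_def c_def)
  next
    case False
    hence "T n (u, v) = 0" for n
      using c_pos[of n] by (auto simp: T_def E_def G_def split: split_indicator)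
    moreover have "I u v = 0"
      using False by (auto simp: I_def)
    ultimately show ?thesis by simp
  qed
  hence I_eq: "(\<lambda>x. \<Sum>n. T n x) = case_prod I"
    by (auto simp: fun_eq_iff sums_iff)
  have int_I: "integrable (lborel \<Otimes>\<^sub>M lborel) (case_prod I)"
    using integrable_suminf[OF int_T _ summable_int] summable_T by (simp add: I_eq)
  have t_sums: "t sums integral\<^sup>L (lborel \<Otimes>\<^sub>M lborel) (case_prod I)"
    using sums_integral[OF int_T _ summable_int] summable_T
    by (simp add: I_eq has_bochner_integral_integral_eq[OF T])
  have "integral\<^sup>L (lborel \<Otimes>\<^sub>M lborel) (case_prod I) = (\<integral>v. \<integral>u. I u v \<partial>lborel \<partial>lborel)"
    using lborel_pair.integral_snd[OF int_I] by simp
  also have "\<dots> = (LINT v:{0<..}|lborel. (LINT u:{0<..}|lborel. gen_polylog_integrand p q a b z u v))"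
    unfolding set_lebesgue_integral_def I_def indicator_times
    by (simp add: mult.commute flip: scaleR_scaleR integral_scaleR_right)
  finally have t_sums': 
    "t sums (LINT v:{0<..}|lborel. (LINT u:{0<..}|lborel. gen_polylog_integrand p q a b z u v))"
    using t_sums by simp

  \<comment> \<open>\<open>Gamma\<close> is 0 only by default, at its poles, the nonpositive
    integers; \<open>Re p > 0\<close> excludes them.\<close>
  have nz: "q \<noteq> 0" "Gamma p \<noteq> 0"
    using assms by (auto simp: Gamma_eq_zero_iff elim!: nonpos_Ints_cases)
  let ?K = "complex_of_real (1 + a) powr p * complex_of_real (1 + b) powr q"
  \<comment> \<open>The prefactor cancels \<open>Gamma p / q\<close> in \<open>t n\<close>, and its
    \<open>z\<close> raises \<open>z ^ n\<close> to the required \<open>z ^ Suc n\<close>.\<close>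
  have "(\<lambda>n. ?K * (z * q / Gamma p * t n)) = (\<lambda>n. ?K / 
           (complex_of_real (real (Suc n) + a) powr p * complex_of_real (real (Suc n) + b) powr q)
           * z ^ Suc n)"
    using nz by (simp add: t_def fun_eq_iff del: of_nat_Suc of_real_add)
  moreover have "(\<lambda>n. ?K * (z * q / Gamma p * t n)) sums (?K * (z * q / Gamma p * 
      (LINT v:{0<..}|lborel. (LINT u:{0<..}|lborel. gen_polylog_integrand p q a b z u v))))"
    by (intro sums_mult t_sums')
  ultimately have "gen_polylog p q a b z = ?K * (z * q / Gamma p * 
      (LINT v:{0<..}|lborel. (LINT u:{0<..}|lborel. gen_polylog_integrand p q a b z u v)))"
    unfolding gen_polylog_def by (simp only: sums_iff)
  moreover have "set_integrable (lborel \<Otimes>\<^sub>M lborel) ({0<..} \<times> {0<..})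
           (\<lambda>(u, v). gen_polylog_integrand p q a b z u v)"
    using int_I by (simp add: set_integrable_def I_def case_prod_unfold)
  ultimately show ?thesis by blast
qed

end
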